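(* Let $X$ and $Y=Y_1\times Y_2$ be Hilbert spaces, let $G=(G_1,G_2)\in\mathcal L(X,Y')$, with $G_i\in\mathcal L(X,Y_i')$, satisfy $\|w\|_X\eqsim\|Gw\|_{Y'}=:|||w|||_X$ for $w\in X$, let $f=(f_1,f_2)\in\operatorname{ran}G$, and let $u\in X$ be the solution of $Gu=f$. Given a set $\mathcal X\subset X$, let the set $\mathcal Y_1\subset Y_1$ be closed under scalar multiplication, and sufficiently large such that $$\alpha:=\inf_{\{w,\tilde w\in\mathcal X\colon G_1(w-\tilde w)\neq0\}}\frac{\sup_{0\neq v\in\mathcal Y_1}\frac{|G_1(w-\tilde w)(v)|}{\|v\|_{Y_1}}}{\|G_1(w-\tilde w)\|_{Y_1'}}>0.$$ Then the Least Squares approximation (assuming that a minimum exists) $$u_{\mathcal X}=\operatorname*{argmin}_{w\in\mathcal X}\tfrac12\Big\{\sup_{0\neq v\in\mathcal Y_1}\frac{|(f_1-G_1w)(v)|^2}{\|v\|_{Y_1}^2}+\|f_2-G_2w\|_{Y_2'}^2\Big\}$$ satisfies $$|||u-u_{\mathcal X}|||_X\leq\Big(1+\frac2\alpha\Big)\inf_{w\in\mathcal X}|||u-w|||_X.$$ If a minimum does not exist, then for any sequence $(u_n)_n\subset\mathcal X$ with $$\lim_n\Big\{\sup_{0\neq v\in\mathcal Y_1}\frac{|(f_1-G_1u_n)(v)|^2}{\|v\|_{Y_1}^2}+\|f_2-G_2u_n\|_{Y_2'}^2\Big\}=\inf_{w\in\mathcal X}\Big\{\sup_{0\neq v\in\mathcal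 Y_1}\frac{|(f_1-G_1w)(v)|^2}{\|v\|_{Y_1}^2}+\|f_2-G_2w\|_{Y_2'}^2\Big\}$$ it holds that $\limsup_n|||u-u_n|||_X\leq\big(1+\frac2\alpha\big)\inf_{w\in\mathcal X}|||u-w|||_X$.
   Context: $\mathcal L(H,K)$ is the space of bounded linear maps between Hilbert spaces, and $'$ denotes the dual. The product $Y=Y_1\times Y_2$ carries the norm $\|(v_1,v_2)\|_Y^2=\|v_1\|_{Y_1}^2+\|v_2\|_{Y_2}^2$, and $Y'$ is identified with $Y_1'\times Y_2'$. The sets $\mathcal X$ and $\mathcal Y_1$ need not be linear subspaces. $C\eqsim D$ means that $C$ and $D$ bound each other up to constant factors (independent of $w\in X$). *)

theory Defs
  imports "HOL-Analysis.Analysis"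
begin

text \<open>
  Hilbert spaces are types of class \<open>{real_inner, complete_space}\<close>; the dual of \<open>'a\<close> is
  \<open>'a \<Rightarrow>\<^sub>L real\<close> with its operator norm. The norm of the product type is
  \<open>sqrt ((norm v1)\<^sup>2 + (norm v2)\<^sup>2)\<close>, as required for \<open>Y = Y1 \<times> Y2\<close>.
  Infima and suprema are taken in \<^typ>\<open>ennreal\<close>, so that a supremum over the empty set is \<open>0\<close>
  and an infimum over the empty set is \<open>\<infinity>\<close>.
\<close>

text \<open>The identification of a pair of functionals \<open>(g1, g2)\<close> with the functional
  \<open>(v1, v2) \<mapsto> g1 v1 + g2 v2\<close> on the product.\<close>

definition dual_pair ::
  "('a::real_normed_vector \<Rightarrow>\<^sub>L real) \<Rightarrow> ('b::real_normed_vector \<Rightarrow>\<^sub>L real) \<Rightarrow> ('a \<times> 'b) \<Rightarrow>\<^sub>L real"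
  where "dual_pair g1 g2 = (g1 o\<^sub>L fst_blinfun) + (g2 o\<^sub>L snd_blinfun)"

lemma dual_pair_apply: "dual_pair g1 g2 (v1, v2) = g1 v1 + g2 v2"
  by (simp add: dual_pair_def blinfun.add_left)

definition energy_norm ::
  "('x::real_normed_vector \<Rightarrow>\<^sub>L ('y::real_normed_vector \<Rightarrow>\<^sub>L real)) \<Rightarrow> 'x \<Rightarrow> real"
  where "energy_norm G w = norm (G w)"

text \<open>If \<open>G1\<close> is constant on \<open>X\<close>, this is an infimum over the empty set, hence \<open>\<infinity>\<close>,
  and then \<open>2 / infsup_const X V G1 = 0\<close>.\<close>

definition infsup_const ::
  "'x::real_normed_vector set \<Rightarrow> 'y::real_normed_vector set \<Rightarrow> ('x \<Rightarrow>\<^sub>L ('y \<Rightarrow>\<^sub>L real)) \<Rightarrow> ennreal"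
  where "infsup_const X V G1 =
    (INF (w, w') \<in> {(w, w'). w \<in> X \<and> w' \<in> X \<and> G1 (w - w') \<noteq> 0}.
      (SUP v \<in> V - {0}. ennreal (\<bar>G1 (w - w') v\<bar> / norm v)) / ennreal (norm (G1 (w - w'))))"

definition ls_functional ::
  "'y1::real_normed_vector set \<Rightarrow>
   ('x::real_normed_vector \<Rightarrow>\<^sub>L ('y1 \<Rightarrow>\<^sub>L real)) \<Rightarrow> ('x \<Rightarrow>\<^sub>L ('y2::real_normed_vector \<Rightarrow>\<^sub>L real)) \<Rightarrow>
   ('y1 \<Rightarrow>\<^sub>L real) \<Rightarrow> ('y2 \<Rightarrow>\<^sub>L real) \<Rightarrow> 'x \<Rightarrow> ennreal"
  where "ls_functional V G1 G2 f1 f2 w =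
    (SUP v \<in> V - {0}. ennreal (\<bar>(f1 - G1 w) v\<bar>\<^sup>2 / (norm v)\<^sup>2)) + ennreal ((norm (f2 - G2 w))\<^sup>2)"

end

theory Submission
  imports Defs
begin

text \<open>
  Write \<open>p g = sup {\<bar>g v\<bar> / \<parallel>v\<parallel> | v \<in> V}\<close> and \<open>D (g\<^sub>1, g\<^sub>2) = sqrt ((p g\<^sub>1)\<^sup>2 + \<parallel>g\<^sub>2\<parallel>\<^sup>2)\<close>. The least squares
  functional is \<open>D\<^sup>2\<close> of the residual, and \<open>D\<close> is a seminorm dominated by the energy norm. On differences
  of elements of \<open>X\<close>, \<open>\<alpha> \<le> 1\<close> shows that conversely the energy norm is at most \<open>D / \<alpha>\<close>, so by the triangle
  inequality, for \<open>w, w' \<in> X\<close>, \<open>|||u - w'||| \<le> |||u - w||| + (D (f - G w) + D (f - G w')) / \<alpha>\<close>.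
  Along a minimizing sequence \<open>w'\<close>, the last term is asymptotically at most \<open>D (f - G w) \<le> |||u - w|||\<close>.
  If \<open>\<alpha> = \<infinity>\<close>, then \<open>G\<^sub>1\<close> is constant on \<open>X\<close>, so that the energy norm of the error and the functional
  differ by a constant after squaring. An exact minimizer is a constant minimizing sequence.
\<close>

section \<open>Dual norms restricted to a set of test vectors\<close>

definition restricted_norm ::
  "'y::real_normed_vector set \<Rightarrow> ('y \<Rightarrow>\<^sub>L real) \<Rightarrow> real"
  where "restricted_norm V g = (SUP v\<in>insert 0 V. \<bar>g v\<bar> / norm v)"
  \<comment> \<open>The point \<open>0\<close> contributes \<open>0 / 0 = 0\<close>; inserting it avoids the supremum of the empty set.\<close>

lemma abs_blinfun_div_norm_le: "\<bar>blinfun_apply g v\<bar> / norm v \<le> norm g"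
  using norm_blinfun[of g v] by (cases "v = 0") (auto simp: divide_simps)

lemma bdd_above_abs_blinfun_div_norm: "bdd_above ((\<lambda>v. \<bar>blinfun_apply g v\<bar> / norm v) ` A)"
  using abs_blinfun_div_norm_le by (intro bdd_aboveI2)

lemma restricted_norm_ge: "v \<in> V \<Longrightarrow> \<bar>blinfun_apply g v\<bar> / norm v \<le> restricted_norm V g"
  unfolding restricted_norm_def by (intro cSUP_upper bdd_above_abs_blinfun_div_norm) auto

lemma restricted_norm_least:
  assumes "0 \<le> c" "\<And>v. v \<in> V \<Longrightarrow> v \<noteq> 0 \<Longrightarrow> \<bar>blinfun_apply g v\<bar> / norm v \<le> c"
  shows "restricted_norm V g \<le> c"
  unfolding restricted_norm_def using assms by (intro cSUP_least) fastforce+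

lemma restricted_norm_nonneg: "0 \<le> restricted_norm V g"
  unfolding restricted_norm_def
  by (rule cSUP_upper2[OF bdd_above_abs_blinfun_div_norm, of 0]) auto

lemma restricted_norm_le_norm: "restricted_norm V g \<le> norm g"
  by (intro restricted_norm_least abs_blinfun_div_norm_le) auto

lemma restricted_norm_diff: "restricted_norm V (g - h) \<le> restricted_norm V g + restricted_norm V h"
proof (rule restricted_norm_least)
  fix v assume v: "v \<in> V"
  have "\<bar>(g - h) v\<bar> / norm v \<le> (\<bar>g v\<bar> + \<bar>h v\<bar>) / norm v"
    by (intro divide_right_mono) (auto simp: blinfun.diff_left abs_triangle_ineq4)
  also have "\<dots> \<le> restricted_norm V g + restricted_norm V h"
    using restricted_norm_ge[OF v, of g] restricted_norm_ge[OF v, of h]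
    by (simp add: add_divide_distrib)
  finally show "\<bar>(g - h) v\<bar> / norm v \<le> restricted_norm V g + restricted_norm V h" .
qed (simp add: restricted_norm_nonneg)

lemma SUP_ennreal_quotient_le:
  "(SUP v\<in>V - {0}. ennreal (\<bar>blinfun_apply g v\<bar> / norm v)) \<le> ennreal (restricted_norm V g)"
  by (intro SUP_least ennreal_leI restricted_norm_ge) auto

text \<open>Squaring commutes with a supremum of nonnegative quantities. The bound from above also
  shows that \<open>?S\<close> is finite; only then can the converse be argued in the reals, where
  every quotient is at most the square root of \<open>?S\<close>.\<close>

lemma SUP_ennreal_quotient_square:
  "(SUP v\<in>V - {0}. ennreal (\<bar>blinfun_apply g v\<bar>\<^sup>2 / (norm v)\<^sup>2)) = ennreal ((restricted_norm V g)\<^sup>2)"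
  (is "?S = _")
proof (rule antisym)
  show le: "?S \<le> ennreal ((restricted_norm V g)\<^sup>2)"
    unfolding power_divide[symmetric]
    by (intro SUP_least ennreal_leI power_mono restricted_norm_ge) auto
  then have fin: "?S < top"
    using ennreal_less_top le_less_trans by blast
  have "restricted_norm V g \<le> sqrt (enn2real ?S)"
  proof (rule restricted_norm_least)
    fix v assume "v \<in> V" "v \<noteq> 0"
    then have "ennreal (\<bar>g v\<bar>\<^sup>2 / (norm v)\<^sup>2) \<le> ?S"
      by (intro SUP_upper) auto
    then have "enn2real (ennreal (\<bar>g v\<bar>\<^sup>2 / (norm v)\<^sup>2)) \<le> enn2real ?S"
      using fin by (intro enn2real_mono)
    then show "\<bar>g v\<bar> / norm v \<le> sqrt (enn2real ?S)"
      by (intro real_le_rsqrt) (simp add: power_divide)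
  qed simp
  then have "(restricted_norm V g)\<^sup>2 \<le> (sqrt (enn2real ?S))\<^sup>2"
    by (intro power_mono restricted_norm_nonneg)
  then have "ennreal ((restricted_norm V g)\<^sup>2) \<le> ennreal (enn2real ?S)"
    by (intro ennreal_leI) simp
  then show "ennreal ((restricted_norm V g)\<^sup>2) \<le> ?S"
    unfolding ennreal_enn2real[OF fin] .
qed

section \<open>The dual norm on a product\<close>

text \<open>The upper bound is Cauchy-Schwarz in the plane. For the lower bound, a suitable test
  vector bounds the sum of the two squared quotients for arbitrary \<open>v1\<close> and
  \<open>v2\<close>; the suprema over \<open>v1\<close> and \<open>v2\<close> are then taken one
  after the other.\<close>

lemma norm_dual_pair:
  fixes g1 :: "'a::real_normed_vector \<Rightarrow>\<^sub>L real" and g2 :: "'b::real_normed_vector \<Rightarrow>\<^sub>L real"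
  shows "norm (dual_pair g1 g2) = sqrt ((norm g1)\<^sup>2 + (norm g2)\<^sup>2)"
proof (rule antisym)
  show "norm (dual_pair g1 g2) \<le> sqrt ((norm g1)\<^sup>2 + (norm g2)\<^sup>2)"
  proof (rule norm_blinfun_bound)
    fix v :: "'a \<times> 'b"
    obtain v1 v2 where v: "v = (v1, v2)" by (cases v)
    have "norm (dual_pair g1 g2 v) \<le> \<bar>g1 v1\<bar> + \<bar>g2 v2\<bar>"
      by (simp add: v dual_pair_apply)
    also have "\<dots> \<le> norm g1 * norm v1 + norm g2 * norm v2"
      using norm_blinfun[of g1 v1] norm_blinfun[of g2 v2] by simp
    also have "\<dots> = inner (norm g1, norm g2) (norm v1, norm v2)"
      by simp
    also have "\<dots> \<le> norm (norm g1, norm g2) * norm (norm v1, norm v2)"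
      by (rule norm_cauchy_schwarz)
    finally show "norm (dual_pair g1 g2 v) \<le> sqrt ((norm g1)\<^sup>2 + (norm g2)\<^sup>2) * norm v"
      by (simp add: v norm_Pair)
  qed simp
next
  define N where "N = norm (dual_pair g1 g2)"
  have quot: "(\<bar>g1 v1\<bar> / norm v1)\<^sup>2 + (\<bar>g2 v2\<bar> / norm v2)\<^sup>2 \<le> N\<^sup>2" for v1 v2
  proof -
    \<comment> \<open>Each \<open>v\<^sub>i\<close> is rescaled to a vector of norm \<open>\<bar>g\<^sub>i v\<^sub>i\<bar> / \<parallel>v\<^sub>i\<parallel>\<close>, the equality case of Cauchy--Schwarz.\<close>
    define q where "q = (\<bar>g1 v1\<bar> / norm v1)\<^sup>2 + (\<bar>g2 v2\<bar> / norm v2)\<^sup>2"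
    define v where "v = ((g1 v1 / (norm v1)\<^sup>2) *\<^sub>R v1, (g2 v2 / (norm v2)\<^sup>2) *\<^sub>R v2)"
    have "0 \<le> q" by (simp add: q_def)
    have "dual_pair g1 g2 v = q"
      by (simp add: v_def dual_pair_apply blinfun.scaleR_right q_def power2_eq_square)
    moreover have "norm v = sqrt q"
      by (simp add: v_def norm_Pair q_def power2_eq_square)
    ultimately have "q \<le> N * sqrt q"
      using norm_blinfun[of "dual_pair g1 g2" v] \<open>0 \<le> q\<close> by (simp add: N_def)
    then have "sqrt q * sqrt q \<le> N * sqrt q"
      using \<open>0 \<le> q\<close> by simp
    then have "sqrt q \<le> N"
      using \<open>0 \<le> q\<close> by (cases "q = 0") (auto simp: N_def intro: mult_right_le_imp_le[of _ "sqrt q"])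
    then show ?thesis
      unfolding q_def[symmetric] by (rule sqrt_le_D)
  qed
  have bound: "norm h \<le> c" if "0 \<le> c" "\<And>v. \<bar>h v\<bar> / norm v \<le> c"
    for h :: "'c::real_normed_vector \<Rightarrow>\<^sub>L real" and c
  proof (rule norm_blinfun_bound)
    show "norm (h v) \<le> c * norm v" for v
      using that(2)[of v] by (cases "v = 0") (auto simp: divide_simps)
  qed fact
  \<comment> \<open>Supremum over \<open>v1\<close> with \<open>v2\<close> fixed. The instance
    \<open>v1 = 0\<close> of \<open>quot\<close> makes the radicand nonnegative, as
    \<open>bound\<close> requires.\<close>
  have "norm g1 \<le> sqrt (N\<^sup>2 - (\<bar>g2 v2\<bar> / norm v2)\<^sup>2)" for v2
    using quot[of 0 v2] quot[of _ v2] by (intro bound real_le_rsqrt) (auto simp: le_diff_eq)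
  then have g1: "(\<bar>g2 v2\<bar> / norm v2)\<^sup>2 \<le> N\<^sup>2 - (norm g1)\<^sup>2" for v2
    using sqrt_ge_absD[of "norm g1"] by (smt (verit) abs_norm_cancel)
  have "norm g2 \<le> sqrt (N\<^sup>2 - (norm g1)\<^sup>2)"
    using g1[of 0] by (intro bound real_le_rsqrt g1) auto
  then have "(norm g2)\<^sup>2 \<le> N\<^sup>2 - (norm g1)\<^sup>2"
    using sqrt_ge_absD[of "norm g2"] by simp
  then show "sqrt ((norm g1)\<^sup>2 + (norm g2)\<^sup>2) \<le> norm (dual_pair g1 g2)"
    by (intro real_le_lsqrt) (auto simp: N_def)
qed

section \<open>The seminorm on residual pairs\<close>

definition restricted_pair_norm ::
  "'y1::real_normed_vector set \<Rightarrow> ('y1 \<Rightarrow>\<^sub>L real) \<Rightarrow> ('y2::real_normed_vector \<Rightarrow>\<^sub>L real) \<Rightarrow> real"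
  where "restricted_pair_norm V g1 g2 = sqrt ((restricted_norm V g1)\<^sup>2 + (norm g2)\<^sup>2)"

lemma restricted_pair_norm_nonneg: "0 \<le> restricted_pair_norm V g1 g2"
  by (simp add: restricted_pair_norm_def)

lemma restricted_pair_norm_le: "restricted_pair_norm V g1 g2 \<le> norm (dual_pair g1 g2)"
  by (simp add: restricted_pair_norm_def norm_dual_pair power_mono restricted_norm_le_norm
      restricted_norm_nonneg)

text \<open>The triangle inequality in each component, followed by the Euclidean one in the
  plane.\<close>

lemma restricted_pair_norm_diff:
  "restricted_pair_norm V (g1 - h1) (g2 - h2)
    \<le> restricted_pair_norm V g1 g2 + restricted_pair_norm V h1 h2"
proof -
  have "restricted_pair_norm V (g1 - h1) (g2 - h2)
      \<le> sqrt ((restricted_norm V g1 + restricted_norm V h1)\<^sup>2 + (norm g2 + norm h2)\<^sup>2)"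
    unfolding restricted_pair_norm_def
    by (intro real_sqrt_le_mono add_mono power_mono restricted_norm_diff norm_triangle_ineq4
        restricted_norm_nonneg norm_ge_zero)
  also have "\<dots> \<le> restricted_pair_norm V g1 g2 + restricted_pair_norm V h1 h2"
    unfolding restricted_pair_norm_def by (rule real_sqrt_sum_squares_triangle_ineq)
  finally show ?thesis .
qed

text \<open>The second component is measured in its full norm, so there the factor \<open>a\<close>
  is harmless because \<open>a \<le> 1\<close>.\<close>

lemma norm_dual_pair_le_restricted:
  assumes "0 < a" "a \<le> 1" "a * norm g1 \<le> restricted_norm V g1"
  shows "a * norm (dual_pair g1 g2) \<le> restricted_pair_norm V g1 g2"
proof -
  have "a * norm (dual_pair g1 g2) = sqrt ((a * norm g1)\<^sup>2 + (a * norm g2)\<^sup>2)"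
    using assms by (simp add: norm_dual_pair power_mult_distrib flip: distrib_left)
      (simp add: real_sqrt_mult)
  also have "\<dots> \<le> restricted_pair_norm V g1 g2"
    unfolding restricted_pair_norm_def using assms
    by (intro real_sqrt_le_mono add_mono power_mono) (auto simp: mult_left_le_one_le)
  finally show ?thesis .
qed

section \<open>The least squares functional and the inf-sup constant in terms of real
  seminorms\<close>

lemma ls_functional_eq:
  "ls_functional V G1 G2 f1 f2 w = ennreal ((restricted_pair_norm V (f1 - G1 w) (f2 - G2 w))\<^sup>2)"
  unfolding ls_functional_def SUP_ennreal_quotient_square
  by (simp add: restricted_pair_norm_def)

text \<open>Clearing the denominator gives a form that also covers \<open>G1 (w - w') = 0\<close>,
  even for an infinite constant, since \<open>top * 0 = 0\<close> in \<open>ennreal\<close>.\<close>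

lemma infsup_const_mult_norm_le:
  assumes "w \<in> X" "w' \<in> X"
  shows "infsup_const X V G1 * ennreal (norm (G1 (w - w'))) \<le> ennreal (restricted_norm V (G1 (w - w')))"
proof (cases "G1 (w - w') = 0")
  case False
  let ?S = "SUP v \<in> V - {0}. ennreal (\<bar>G1 (w - w') v\<bar> / norm v)"
  have "infsup_const X V G1 \<le> ?S / ennreal (norm (G1 (w - w')))"
    unfolding infsup_const_def using assms False by (intro INF_lower2[of "(w, w')"]) auto
  then have "infsup_const X V G1 * ennreal (norm (G1 (w - w')))
      \<le> ?S / ennreal (norm (G1 (w - w'))) * ennreal (norm (G1 (w - w')))"
    by (rule mult_right_mono) simp
  also have "\<dots> = ?S"
    using False by (simp add: ennreal_divide_times ennreal_times_divide mult_divide_eq_ennreal)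
  also note SUP_ennreal_quotient_le
  finally show ?thesis .
qed simp

text \<open>An infinite constant times a nonzero norm would exceed the finite restricted norm, so
  all differences vanish under \<open>G1\<close>. A finite constant forces some nonzero difference,
  since an empty infimum is \<open>top\<close>; comparing its restricted norm with its full norm
  gives \<open>a \<le> 1\<close>.\<close>

lemma infsup_const_cases:
  obtains (infinite) "infsup_const X V G1 = top" "\<And>w w'. w \<in> X \<Longrightarrow> w' \<in> X \<Longrightarrow> G1 w = G1 w'"
  | (finite) a where "infsup_const X V G1 = ennreal a" "0 \<le> a" "a \<le> 1"
      "\<And>w w'. w \<in> X \<Longrightarrow> w' \<in> X \<Longrightarrow> a * norm (G1 (w - w')) \<le> restricted_norm V (G1 (w - w'))"
proof (cases "infsup_const X V G1")
  case top
  have "G1 w = G1 w'" if "w \<in> X" "w' \<in> X" for w w'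
  proof (rule ccontr)
    assume "G1 w \<noteq> G1 w'"
    then have "infsup_const X V G1 * ennreal (norm (G1 (w - w'))) = top"
      by (simp add: top ennreal_top_mult blinfun.diff_right)
    then show False
      using infsup_const_mult_norm_le[OF that, of V G1] by (simp add: top_unique)
  qed
  with top infinite show thesis by blast
next
  case (real a)
  have le: "a * norm (G1 (w - w')) \<le> restricted_norm V (G1 (w - w'))" if "w \<in> X" "w' \<in> X" for w w'
    using infsup_const_mult_norm_le[OF that, of V G1] real
    by (simp add: ennreal_le_iff[OF restricted_norm_nonneg] flip: ennreal_mult)
  have "{(w, w'). w \<in> X \<and> w' \<in> X \<and> G1 (w - w') \<noteq> 0} \<noteq> {}"
  proof
    assume "{(w, w'). w \<in> X \<and> w' \<in> X \<and> G1 (w - w') \<noteq> 0} = {}"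
    then have "infsup_const X V G1 = top"
      unfolding infsup_const_def by (simp only:) simp
    with real show False by simp
  qed
  then obtain w w' where "w \<in> X" "w' \<in> X" "G1 (w - w') \<noteq> 0" by auto
  moreover from this have "a * norm (G1 (w - w')) \<le> norm (G1 (w - w'))"
    using le restricted_norm_le_norm order_trans by blast
  ultimately have "a \<le> 1" by simp
  with real le finite show thesis by blast
qed

section \<open>Quasi-optimality of minimizing sequences\<close>

text \<open>The estimate is proved for each fixed competitor \<open>w\<close> in \<open>X\<close>;
  the infimum over \<open>w\<close> is taken only at the end.\<close>

lemma minimizing_sequence_quasi_optimal:
  fixes G :: "'x::real_normed_vector \<Rightarrow>\<^sub>L (('y1::real_normed_vector \<times> 'y2::real_normed_vector) \<Rightarrow>\<^sub>L real)"
    and G1 :: "'x \<Rightarrow>\<^sub>L ('y1 \<Rightarrow>\<^sub>L real)" and G2 :: "'x \<Rightarrow>\<^sub>L ('y2 \<Rightarrow>\<^sub>L real)"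
  assumes G: "\<And>w. G w = dual_pair (G1 w) (G2 w)"
    and u: "G u = dual_pair f1 f2"
    and pos: "infsup_const X V G1 > 0"
    and s: "\<And>n. s n \<in> X"
    and lim: "(\<lambda>n. ls_functional V G1 G2 f1 f2 (s n)) \<longlonglongrightarrow> (INF w\<in>X. ls_functional V G1 G2 f1 f2 w)"
  shows "limsup (\<lambda>n. ennreal (energy_norm G (u - s n)))
    \<le> (1 + 2 / infsup_const X V G1) * (INF w\<in>X. ennreal (energy_norm G (u - w)))"
proof -
  let ?\<alpha> = "infsup_const X V G1"
  define E where "E w = energy_norm G (u - w)" for w
  define D where "D w = restricted_pair_norm V (f1 - G1 w) (f2 - G2 w)" for w
  have D0: "0 \<le> D w" for w
    by (simp add: D_def restricted_pair_norm_nonneg)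
  have dual_diff: "dual_pair g1 g2 - dual_pair h1 h2 = dual_pair (g1 - h1) (g2 - h2)"
    for g1 h1 :: "'y1 \<Rightarrow>\<^sub>L real" and g2 h2 :: "'y2 \<Rightarrow>\<^sub>L real"
    by (rule blinfun_eqI) (auto simp: dual_pair_apply blinfun.diff_left)
  have E_eq: "E w = norm (dual_pair (f1 - G1 w) (f2 - G2 w))" for w
    by (simp only: E_def energy_norm_def blinfun.diff_right[of G] u) (simp only: G dual_diff)
  have D_le_E: "D w \<le> E w" for w
    unfolding D_def E_eq by (rule restricted_pair_norm_le)
  \<comment> \<open>The excess is written as a square so that it can be absorbed into the square of
    a sum before taking roots.\<close>
  have nearly_min: "\<forall>\<^sub>F n in sequentially. (D (s n))\<^sup>2 < (D w)\<^sup>2 + \<delta>\<^sup>2" if "w \<in> X" "0 < \<delta>" for w and \<delta> :: real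
  proof -
    have "(INF w\<in>X. ls_functional V G1 G2 f1 f2 w) \<le> ennreal ((D w)\<^sup>2)"
      using that by (intro INF_lower2[of w]) (auto simp: ls_functional_eq D_def)
    also have "\<dots> < ennreal ((D w)\<^sup>2 + \<delta>\<^sup>2)"
      using that by (intro ennreal_lessI) (auto intro!: add_nonneg_pos)
    finally have "\<forall>\<^sub>F n in sequentially. ls_functional V G1 G2 f1 f2 (s n) < ennreal ((D w)\<^sup>2 + \<delta>\<^sup>2)"
      by (rule order_tendstoD(2)[OF lim])
    then show ?thesis
      unfolding ls_functional_eq D_def[symmetric] by (simp only: ennreal_less_iff zero_le_power2)
  qed
  have limsup_le: "limsup (\<lambda>n. ennreal (E (s n))) \<le> ennreal c"
    if "0 \<le> c" "\<And>e. 0 < e \<Longrightarrow> \<forall>\<^sub>F n in sequentially. E (s n) \<le> c + e" for c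
  proof (rule ennreal_le_epsilon)
    fix e :: real assume "0 < e"
    then have "\<forall>\<^sub>F n in sequentially. ennreal (E (s n)) \<le> ennreal c + ennreal e"
      using that by (auto elim!: eventually_mono simp: ennreal_leI simp flip: ennreal_plus)
    then show "limsup (\<lambda>n. ennreal (E (s n))) \<le> ennreal c + ennreal e"
      by (rule Limsup_bounded)
  qed
  have quasi_opt: "limsup (\<lambda>n. ennreal (E (s n))) \<le> (1 + 2 / ?\<alpha>) * ennreal (E w)" if w: "w \<in> X" for w
  proof (cases rule: infsup_const_cases[of X V G1])
    case infinite
    have "limsup (\<lambda>n. ennreal (E (s n))) \<le> ennreal (E w)"
    proof (rule limsup_le)
      fix e :: real assume "0 < e"
      show "\<forall>\<^sub>F n in sequentially. E (s n) \<le> E w + e"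
        using nearly_min[OF w \<open>0 < e\<close>]
      proof eventually_elim
        case (elim n)
        \<comment> \<open>The first components of both residuals agree, so passing from
          \<open>D\<close> to \<open>E\<close> adds the same constant to both squares.\<close>
        have "G1 (s n) = G1 w"
          using infinite w s by blast
        then have "(E (s n))\<^sup>2 \<le> (E w)\<^sup>2 + e\<^sup>2"
          using elim by (simp add: E_eq D_def norm_dual_pair restricted_pair_norm_def)
        also have "\<dots> \<le> (E w + e)\<^sup>2"
          using \<open>0 < e\<close> by (simp add: power2_sum E_eq)
        finally show ?case
          by (rule power2_le_imp_le) (use \<open>0 < e\<close> in \<open>simp add: E_eq\<close>)
      qed
    qed (simp add: E_eq)
    then show ?thesis
      using infinite by simp
  next
    case (finite a)
    with pos have a: "0 < a" by simp
    \<comment> \<open>The difference of the two residuals is \<open>G (w - s n)\<close>, a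
      difference of elements of \<open>X\<close>, where the inf-sup bound applies; it need not hold
      for \<open>u - s n\<close>.\<close>
    have E_s: "a * E (s n) \<le> a * E w + (D w + D (s n))" for n
    proof -
      have "a * norm (dual_pair (G1 (w - s n)) (G2 (w - s n)))
          \<le> restricted_pair_norm V (G1 (w - s n)) (G2 (w - s n))"
        using a finite s w by (intro norm_dual_pair_le_restricted) auto
      also have "G1 (w - s n) = (f1 - G1 (s n)) - (f1 - G1 w)"
        by (simp add: blinfun.diff_right)
      also have "G2 (w - s n) = (f2 - G2 (s n)) - (f2 - G2 w)"
        by (simp add: blinfun.diff_right)
      also have "restricted_pair_norm V ((f1 - G1 (s n)) - (f1 - G1 w)) ((f2 - G2 (s n)) - (f2 - G2 w))
          \<le> D (s n) + D w"
        unfolding D_def by (rule restricted_pair_norm_diff)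
      finally have "a * norm (dual_pair (f1 - G1 (s n)) (f2 - G2 (s n)) - dual_pair (f1 - G1 w) (f2 - G2 w))
          \<le> D (s n) + D w"
        by (simp only: dual_diff)
      moreover have "E (s n) \<le> E w
          + norm (dual_pair (f1 - G1 (s n)) (f2 - G2 (s n)) - dual_pair (f1 - G1 w) (f2 - G2 w))"
        unfolding E_eq by (rule norm_triangle_sub)
      then have "a * E (s n) \<le> a * (E w
          + norm (dual_pair (f1 - G1 (s n)) (f2 - G2 (s n)) - dual_pair (f1 - G1 w) (f2 - G2 w)))"
        using a by simp
      ultimately show ?thesis
        by (simp add: distrib_left)
    qed
    have "limsup (\<lambda>n. ennreal (E (s n))) \<le> ennreal ((1 + 2 / a) * E w)"
    proof (rule limsup_le)
      fix e :: real assume "0 < e"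
      \<comment> \<open>The tolerance \<open>a * e\<close> becomes \<open>e\<close> after the final
        division by \<open>a\<close>.\<close>
      then have "0 < a * e" using a by simp
      show "\<forall>\<^sub>F n in sequentially. E (s n) \<le> (1 + 2 / a) * E w + e"
        using nearly_min[OF w \<open>0 < a * e\<close>]
      proof eventually_elim
        case (elim n)
        also have "(D w)\<^sup>2 + (a * e)\<^sup>2 \<le> (D w + a * e)\<^sup>2"
          using \<open>0 < a * e\<close> D0[of w] by (simp add: power2_sum)
        finally have "D (s n) < D w + a * e"
          by (rule power2_less_imp_less) (use \<open>0 < a * e\<close> D0[of w] in simp)
        then have "a * E (s n) \<le> a * E w + (2 * E w + a * e)"
          using E_s[of n] D_le_E[of w] by linarith
        also have "\<dots> = a * ((1 + 2 / a) * E w + e)"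
          using a by (simp add: field_simps)
        finally show ?case
          using a by simp
      qed
    qed (use a in \<open>simp add: E_eq\<close>)
    also have "\<dots> = (1 + 2 / ?\<alpha>) * ennreal (E w)"
    proof -
      have "1 + 2 / ?\<alpha> = ennreal (1 + 2 / a)"
        using a finite(1) by (simp add: ennreal_plus divide_ennreal flip: ennreal_numeral)
      then show ?thesis
        using a by (simp add: ennreal_mult E_eq)
    qed
    finally show ?thesis .
  qed
  define c where "c = 1 + 2 / ?\<alpha>"
  define S where "S = limsup (\<lambda>n. ennreal (E (s n)))"
  \<comment> \<open>Finiteness of \<open>c\<close> comes from \<alpha> > 0. Being positive and
    finite, \<open>c\<close> can be divided out before the infimum is taken and multiplied back
    afterwards.\<close>
  have c: "0 < c" "c < top"
    using pos by (auto simp: c_def ennreal_divide_eq_top_iff add_pos_nonneg simp flip: less_top)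
  have "S / c \<le> (INF w\<in>X. ennreal (E w))"
    using c(1) quasi_opt unfolding S_def c_def by (intro INF_greatest divide_le_posI_ennreal)
  then have "c * (S / c) \<le> c * (INF w\<in>X. ennreal (E w))"
    by (rule mult_left_mono) simp
  moreover have "c * (S / c) = S"
    using c mult_divide_eq_ennreal[of c S] by (simp add: ennreal_times_divide mult.commute)
  ultimately show ?thesis
    by (simp only: E_def S_def c_def)
qed

theorem proposition6p1:
  fixes G :: "'x::{real_inner, complete_space} \<Rightarrow>\<^sub>L
              (('y1::{real_inner, complete_space} \<times> 'y2::{real_inner, complete_space}) \<Rightarrow>\<^sub>L real)"
    and G1 :: "'x \<Rightarrow>\<^sub>L ('y1 \<Rightarrow>\<^sub>L real)"
    and G2 :: "'x \<Rightarrow>\<^sub>L ('y2 \<Rightarrow>\<^sub>L real)"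
    and f :: "('y1 \<times> 'y2) \<Rightarrow>\<^sub>L real"
    and f1 :: "'y1 \<Rightarrow>\<^sub>L real"
    and f2 :: "'y2 \<Rightarrow>\<^sub>L real"
    and u :: 'x
    and X :: "'x set"
    and V :: "'y1 set"
    and \<alpha> :: ennreal
  assumes G_pair: "\<forall>w. G w = dual_pair (G1 w) (G2 w)"
    and norm_equiv: "\<exists>c>0. \<exists>C>0. \<forall>w. c * norm w \<le> energy_norm G w \<and> energy_norm G w \<le> C * norm w"
    and f_pair: "f = dual_pair f1 f2"
    and f_range: "f \<in> range (blinfun_apply G)"
    and u_sol: "G u = f"
    and V_scale: "\<forall>c. \<forall>v\<in>V. c *\<^sub>R v \<in> V"
    and alpha_eq: "\<alpha> = infsup_const X V G1"
    and alpha_pos: "\<alpha> > 0"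
  shows "(\<forall>uX. is_arg_min (\<lambda>w. (1/2) * ls_functional V G1 G2 f1 f2 w) (\<lambda>w. w \<in> X) uX \<longrightarrow>
            ennreal (energy_norm G (u - uX))
              \<le> (1 + 2 / \<alpha>) * (INF w\<in>X. ennreal (energy_norm G (u - w))))
       \<and> ((\<nexists>uX. is_arg_min (\<lambda>w. (1/2) * ls_functional V G1 G2 f1 f2 w) (\<lambda>w. w \<in> X) uX) \<longrightarrow>
          (\<forall>s. (\<forall>n. s n \<in> X) \<longrightarrow>
            ((\<lambda>n. ls_functional V G1 G2 f1 f2 (s n)) \<longlonglongrightarrow> (INF w\<in>X. ls_functional V G1 G2 f1 f2 w)) \<longrightarrow>
            limsup (\<lambda>n. ennreal (energy_norm G (u - s n)))
              \<le> (1 + 2 / \<alpha>) * (INF w\<in>X. ennreal (energy_norm G (u - w)))))"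
proof -
  let ?L = "ls_functional V G1 G2 f1 f2"
  have main: "limsup (\<lambda>n. ennreal (energy_norm G (u - s n)))
      \<le> (1 + 2 / \<alpha>) * (INF w\<in>X. ennreal (energy_norm G (u - w)))"
    if "\<And>n. s n \<in> X" "(\<lambda>n. ?L (s n)) \<longlonglongrightarrow> (INF w\<in>X. ?L w)" for s
    unfolding alpha_eq using that alpha_pos G_pair u_sol f_pair alpha_eq
    by (intro minimizing_sequence_quasi_optimal) auto
  have "ennreal (energy_norm G (u - uX)) \<le> (1 + 2 / \<alpha>) * (INF w\<in>X. ennreal (energy_norm G (u - w)))"
    if "is_arg_min (\<lambda>w. (1/2) * ?L w) (\<lambda>w. w \<in> X) uX" for uX
  proof -
    have uX: "uX \<in> X" "\<And>w. w \<in> X \<Longrightarrow> (1/2) * ?L uX \<le> (1/2) * ?L w"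
      using that by (auto simp: is_arg_min_linorder)
    have "?L uX \<le> ?L w" if "w \<in> X" for w
    proof -
      \<comment> \<open>Doubling removes the factor 1/2, so that a minimizer attains the infimum of
        \<open>?L\<close> itself.\<close>
      have "2 * ((1/2) * ?L uX) \<le> 2 * ((1/2) * ?L w)"
        using uX(2)[OF that] by (rule mult_left_mono) simp
      moreover have "2 * (1/2) = (1::ennreal)"
        by (simp add: ennreal_times_divide)
      ultimately show ?thesis
        by (simp only: mult.assoc[symmetric] mult_1_left)
    qed
    then have "?L uX = (INF w\<in>X. ?L w)"
      using uX(1) by (intro antisym INF_greatest INF_lower) auto
    then show ?thesis
      using main[of "\<lambda>_. uX"] uX(1) by (simp add: Limsup_const)
  qed
  with main show ?thesis by blast
qed

end
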